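(* Let $G$ be a graph in $\varepsilon_0$. Then for every pair of adjacent vertices $u,v$ of $G$, the maximum number of pairwise edge-disjoint $u$–$v$ paths in $G$ is exactly $2$.
   Context: All graphs are finite, simple, undirected and connected. An Euler graph is a connected graph in which every vertex has even degree. $\varepsilon_0$ denotes the class of Euler graphs $G$ such that every cycle of $G$ has length $n\equiv 0 \pmod 4$. *)

theory Defs
  imports Main
begin

definition simple_graph :: "'a set \<Rightarrow> 'a set set \<Rightarrow> bool" where
  "simple_graph V E \<longleftrightarrow> finite V \<and> (\<forall>e\<in>E. e \<subseteq> V \<and> card e = 2)"

definition degree :: "'a set set \<Rightarrow> 'a \<Rightarrow> nat" where
  "degree E v = card {e \<in> E. v \<in> e}"

(* Walks, paths and cycles are given by their lists of vertices. *)

fun walk_edges :: "'a list \<Rightarrow> 'a set set" where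
  "walk_edges (x # y # xs) = insert {x, y} (walk_edges (y # xs))"
| "walk_edges xs = {}"

definition is_walk :: "'a set \<Rightarrow> 'a set set \<Rightarrow> 'a list \<Rightarrow> bool" where
  "is_walk V E p \<longleftrightarrow> p \<noteq> [] \<and> set p \<subseteq> V \<and> walk_edges p \<subseteq> E"

definition paths :: "'a set \<Rightarrow> 'a set set \<Rightarrow> 'a \<Rightarrow> 'a \<Rightarrow> 'a list set" where
  "paths V E u v = {p. is_walk V E p \<and> distinct p \<and> hd p = u \<and> last p = v}"

definition connected_graph :: "'a set \<Rightarrow> 'a set set \<Rightarrow> bool" where
  "connected_graph V E \<longleftrightarrow> V \<noteq> {} \<and> (\<forall>u\<in>V. \<forall>v\<in>V. paths V E u v \<noteq> {})"

(* The first vertex is not repeated at the end of the list, so the number of edges of the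
   cycle is the length of the list. *)
definition is_cycle :: "'a set \<Rightarrow> 'a set set \<Rightarrow> 'a list \<Rightarrow> bool" where
  "is_cycle V E c \<longleftrightarrow> length c \<ge> 3 \<and> distinct c \<and> is_walk V E c \<and> {last c, hd c} \<in> E"

definition euler_graph :: "'a set \<Rightarrow> 'a set set \<Rightarrow> bool" where
  "euler_graph V E \<longleftrightarrow>
     simple_graph V E \<and> connected_graph V E \<and> (\<forall>v\<in>V. even (degree E v))"

definition epsilon0 :: "'a set \<Rightarrow> 'a set set \<Rightarrow> bool" where
  "epsilon0 V E \<longleftrightarrow> euler_graph V E \<and> (\<forall>c. is_cycle V E c \<longrightarrow> length c mod 4 = 0)"

definition edge_disjoint :: "'a list set \<Rightarrow> bool" where
  "edge_disjoint P \<longleftrightarrow> pairwise (\<lambda>p q. disjnt (walk_edges p) (walk_edges q)) P"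

(* Intended for distinct u and v: every u-v path then has an edge, so sets of paths and
   indexed families of paths give the same maximum. *)
definition max_edge_disjoint_paths :: "'a set \<Rightarrow> 'a set set \<Rightarrow> 'a \<Rightarrow> 'a \<Rightarrow> nat" where
  "max_edge_disjoint_paths V E u v = Max (card ` {P. P \<subseteq> paths V E u v \<and> edge_disjoint P})"

lemma finite_paths: "finite (paths V E u v)" if "simple_graph V E"
proof (rule finite_subset)
  show "paths V E u v \<subseteq> {xs. set xs \<subseteq> V \<and> length xs \<le> card V}"
    using that
    by (auto simp: paths_def is_walk_def simple_graph_def) (metis card_mono distinct_card)
  show "finite {xs. set xs \<subseteq> V \<and> length xs \<le> card V}"
    using that by (simp add: simple_graph_def finite_lists_length_le)
qed

(* Hence the maximum is taken over a finite non-empty set. *)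
lemma max_edge_disjoint_paths_wf:
  assumes "simple_graph V E"
  shows "finite (card ` {P. P \<subseteq> paths V E u v \<and> edge_disjoint P})"
    and "card ` {P. P \<subseteq> paths V E u v \<and> edge_disjoint P} \<noteq> {}"
proof -
  show "finite (card ` {P. P \<subseteq> paths V E u v \<and> edge_disjoint P})"
    using finite_paths[OF assms, of u v] by simp
  have "{} \<in> {P. P \<subseteq> paths V E u v \<and> edge_disjoint P}"
    by (simp add: edge_disjoint_def)
  then show "card ` {P. P \<subseteq> paths V E u v \<and> edge_disjoint P} \<noteq> {}"
    by blast
qed

end

theory Submission
  imports Defs
begin

text \<open>
  An edge set with all degrees even splits into edge-disjoint cycles, so under the hypothesis on
  cycle lengths its size is divisible by 4. A \<open>u\<close>-\<open>v\<close> path avoiding the edge \<open>uv\<close> closes up to a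
  cycle, so it has 3 edges modulo 4. The union of two edge-disjoint such paths would be an even
  edge set of size 2 modulo 4, which is impossible; hence besides \<open>uv\<close> itself at most one path
  fits. One does fit, because in \<open>G - uv\<close> the only vertices of odd degree are \<open>u\<close> and \<open>v\<close>, and a
  trail leaving \<open>u\<close> cannot get stuck before \<open>v\<close>.
\<close>

lemma simple_graph_finite: "finite E" if "simple_graph V E"
  using that finite_subset[of E "Pow V"] by (auto simp: simple_graph_def)

lemma simple_graph_subset: "simple_graph V F" if "simple_graph V E" "F \<subseteq> E"
  using that by (auto simp: simple_graph_def)

lemma simple_graph_edgeD:
  assumes "simple_graph V E" "{u, v} \<in> E"
  shows "u \<noteq> v" "u \<in> V" "v \<in> V"
proof -
  have "card {u, v} = 2" "{u, v} \<subseteq> V"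
    using assms by (auto simp: simple_graph_def)
  then show "u \<noteq> v" "u \<in> V" "v \<in> V" by auto
qed

lemma degree_Un_disjoint:
  assumes "finite A" "finite B" "A \<inter> B = {}"
  shows "degree (A \<union> B) x = degree A x + degree B x"
proof -
  have "{e \<in> A \<union> B. x \<in> e} = {e \<in> A. x \<in> e} \<union> {e \<in> B. x \<in> e}" by auto
  then show ?thesis
    unfolding degree_def using assms by (simp add: card_Un_disjoint disjoint_iff)
qed

lemma degree_insert:
  assumes "finite A" "e \<notin> A"
  shows "degree (insert e A) x = degree A x + (if x \<in> e then 1 else 0)"
proof -
  have "degree {e} x = (if x \<in> e then 1 else 0)"
    by (auto simp: degree_def Collect_conv_if)
  then show ?thesis
    using degree_Un_disjoint[of A "{e}" x] assms by simp
qed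

lemma finite_walk_edges: "finite (walk_edges p)"
  by (induction p rule: walk_edges.induct) auto

lemma walk_edges_subset_set: "e \<in> walk_edges p \<Longrightarrow> e \<subseteq> set p"
  by (induction p rule: walk_edges.induct) auto

lemma walk_edges_append_right: "walk_edges q \<subseteq> walk_edges (p @ q)"
proof (induction p)
  case (Cons x p)
  then show ?case by (cases "p @ q") auto
qed simp

lemma first_edge_notin_walk_edges: "x \<notin> set p \<Longrightarrow> {x, y} \<notin> walk_edges p"
  using walk_edges_subset_set by fastforce

lemma card_walk_edges: "distinct p \<Longrightarrow> card (walk_edges p) = length p - 1"
proof (induction p rule: walk_edges.induct)
  case (1 x y xs)
  then show ?case
    using first_edge_notin_walk_edges[of x "y # xs" y]
    by (simp add: finite_walk_edges)
qed auto

text \<open>Prepending a vertex \<open>a\<close> to a path starting at \<open>b\<close> adds the new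
  edge \<open>{a, b}\<close>, which flips the parity at \<open>a\<close> and \<open>b\<close> only,
  so the odd end moves from \<open>b\<close> to \<open>a\<close>. The conjunct
  \<open>hd p \<noteq> last p\<close> accounts for one-vertex paths, which have no edges.\<close>

lemma odd_degree_walk_edges:
  assumes "distinct p" "p \<noteq> []"
  shows "odd (degree (walk_edges p) x) \<longleftrightarrow> hd p \<noteq> last p \<and> (x = hd p \<or> x = last p)"
  using assms
proof (induction p rule: walk_edges.induct)
  case (1 a b xs)
  have "last (b # xs) \<in> set (b # xs)" by (rule last_in_set) simp
  then have "a \<noteq> last (b # xs)" using "1.prems" by auto
  moreover have "{a, b} \<notin> walk_edges (b # xs)"
    using "1.prems" by (intro first_edge_notin_walk_edges) auto
  ultimately show ?case
    using 1 by (auto simp: degree_insert finite_walk_edges)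
qed (auto simp: degree_def)

lemma paths_mono: "F \<subseteq> E \<Longrightarrow> paths V F u v \<subseteq> paths V E u v"
  by (auto simp: paths_def is_walk_def)

text \<open>If the path from \<open>w\<close> already visits \<open>u\<close>, its tail from
  \<open>u\<close> on serves; otherwise \<open>u\<close> is prepended. This lets a trail be followed
  edge by edge while vertices stay distinct.\<close>

lemma path_ConsE:
  assumes "{u, w} \<in> E" "u \<in> V" "paths V E w v \<noteq> {}"
  shows "paths V E u v \<noteq> {}"
proof -
  obtain p where p: "p \<noteq> []" "set p \<subseteq> V" "walk_edges p \<subseteq> E" "distinct p" "hd p = w" "last p = v"
    using assms(3) by (auto simp: paths_def is_walk_def)
  show ?thesis
  proof (cases "u \<in> set p")
    case True
    then obtain xs ys where "p = xs @ u # ys" by (meson split_list)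
    then have "u # ys \<in> paths V E u v"
      using p walk_edges_append_right[of "u # ys" xs] by (auto simp: paths_def is_walk_def)
    then show ?thesis by blast
  next
    case False
    obtain ys where "p = w # ys" using p by (cases p) auto
    then have "u # p \<in> paths V E u v"
      using p False assms by (auto simp: paths_def is_walk_def)
    then show ?thesis by blast
  qed
qed

text \<open>Induction on the number of edges: an odd degree at \<open>u\<close> provides an edge
  \<open>{u, w}\<close>, and deleting it moves the odd vertex from \<open>u\<close> to
  \<open>w\<close>. The start vertex therefore varies in the induction.\<close>

lemma path_between_odd_vertices:
  assumes "simple_graph V F" "u \<noteq> v" "\<And>x. odd (degree F x) \<longleftrightarrow> x = u \<or> x = v"
  shows "paths V F u v \<noteq> {}"
  using assms
proof (induction "card F" arbitrary: F u rule: less_induct)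
  case less
  have fin: "finite F" using less.prems(1) by (rule simple_graph_finite)
  have "degree F u \<noteq> 0" using less.prems(3)[of u] by (auto intro: ccontr)
  then obtain e where e: "e \<in> F" "u \<in> e"
    unfolding degree_def by (metis (mono_tags, lifting) card.empty empty_Collect_eq)
  moreover have "card e = 2" using e less.prems(1) by (simp add: simple_graph_def)
  ultimately obtain w where w: "e = {u, w}"
    by (auto simp: card_2_iff)
  have uw: "u \<noteq> w" "u \<in> V" "w \<in> V"
    using simple_graph_edgeD[OF less.prems(1)] e w by auto
  define F' where "F' = F - {e}"
  have F: "F = insert e F'" "e \<notin> F'" "finite F'" using e fin by (auto simp: F'_def)
  have sub: "F' \<subseteq> F" by (simp add: F'_def)
  have "paths V F w v \<noteq> {}"
  proof (cases "w = v")
    \<comment> \<open>Here the deletion leaves no odd vertex at all, so the induction hypothesis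
      does not apply; the trail has arrived.\<close>
    case True
    then have "[v] \<in> paths V F w v" using uw by (auto simp: paths_def is_walk_def)
    then show ?thesis by blast
  next
    case False
    have odd: "odd (degree F' x) \<longleftrightarrow> x = w \<or> x = v" for x
      using less.prems(2) less.prems(3)[of x] degree_insert[OF F(3,2), of x] F(1) w uw False
      by (auto split: if_splits)
    have "paths V F' w v \<noteq> {}"
      using less.hyps[OF _ simple_graph_subset[OF less.prems(1) sub] False odd] F by simp
    then show ?thesis using paths_mono[OF sub] by blast
  qed
  then show ?case using path_ConsE e w uw by metis
qed

lemma path_avoiding_edge:
  assumes "simple_graph V F" "\<And>x. even (degree F x)" "{u, v} \<in> F"
  shows "paths V (F - {{u, v}}) u v \<noteq> {}"
proof (rule path_between_odd_vertices)
  let ?F = "F - {{u, v}}"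
  show "simple_graph V ?F" using simple_graph_subset[OF assms(1)] by blast
  show "u \<noteq> v" using simple_graph_edgeD[OF assms(1,3)] by simp
  have "insert {u, v} ?F = F" using assms(3) by blast
  then show "odd (degree ?F x) \<longleftrightarrow> x = u \<or> x = v" for x
    using degree_insert[of ?F "{u, v}" x] assms(2)[of x] simple_graph_finite[OF assms(1)]
    by (auto split: if_splits)
qed

text \<open>Cycles do not repeat their first vertex, so the list \<open>p\<close> itself is the
  cycle and \<open>{u, v}\<close> its closing edge.\<close>

lemma path_closes_to_cycle:
  assumes "{u, v} \<in> E" "u \<noteq> v" "p \<in> paths V E u v" "{u, v} \<notin> walk_edges p"
  shows "is_cycle V E p"
proof -
  have p: "is_walk V E p" "distinct p" "hd p = u" "last p = v"
    using assms(3) by (auto simp: paths_def)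
  obtain a b c xs where "p = a # b # c # xs"
    \<comment> \<open>Shorter lists are impossible: a single vertex would give \<open>u = v\<close>,
      and two vertices would use the edge \<open>{u, v}\<close>.\<close>
    using p assms(2,4) by (cases p rule: walk_edges.cases; cases "tl (tl p)")
      (auto simp: is_walk_def)
  then show ?thesis
    using p assms(1) by (auto simp: is_cycle_def insert_commute)
qed

text \<open>Strong induction, removing one cycle at a time. The cycle condition stays on
  \<open>E\<close> while \<open>F\<close> shrinks: every cycle found in \<open>F\<close> is one of
  \<open>E\<close>, and \<open>F\<close> may become disconnected.\<close>

lemma card_even_edge_set_mod_4:
  assumes "simple_graph V E" "\<And>c. is_cycle V E c \<Longrightarrow> length c mod 4 = 0"
    and "F \<subseteq> E" "\<And>x. even (degree F x)"
  shows "card F mod 4 = 0"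
  using assms(3,4)
proof (induction "card F" arbitrary: F rule: less_induct)
  case less
  have sF: "simple_graph V F" using simple_graph_subset assms(1) less.prems(1) .
  have fin: "finite F" using sF by (rule simple_graph_finite)
  show ?case
  proof (cases "F = {}")
    case False
    then obtain u v where uv: "{u, v} \<in> F"
      using sF by (auto simp: simple_graph_def card_2_iff) (metis ex_in_conv)
    have neq: "u \<noteq> v" using simple_graph_edgeD[OF sF uv] by simp
    obtain p where p: "p \<in> paths V (F - {{u, v}}) u v"
      using path_avoiding_edge[OF sF less.prems(2) uv] by blast
    then have pw: "p \<noteq> []" "walk_edges p \<subseteq> F - {{u, v}}" "distinct p" "hd p = u" "last p = v"
      by (auto simp: paths_def is_walk_def)
    have "p \<in> paths V E u v" using p paths_mono[of "F - {{u, v}}" E] less.prems(1) by blast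
    then have "is_cycle V E p"
      using path_closes_to_cycle[of u v E p V] uv less.prems(1) neq pw(2) by blast
    then have len: "length p mod 4 = 0" by (rule assms(2))
    define C where "C = insert {u, v} (walk_edges p)"
    have new: "{u, v} \<notin> walk_edges p" using pw(2) by blast
    have CF: "C \<subseteq> F" using uv pw(2) by (auto simp: C_def)
    \<comment> \<open>The path is odd exactly at \<open>u\<close> and \<open>v\<close>, and the
      closing edge corrects both.\<close>
    have "even (degree C x)" for x
      using odd_degree_walk_edges[OF pw(3,1), of x] pw neq new
      by (auto simp: C_def degree_insert finite_walk_edges)
    moreover have "degree F x = degree C x + degree (F - C) x" for x
      using degree_Un_disjoint[of C "F - C" x] CF fin finite_subset[OF CF fin]
      by (simp add: Un_absorb1)
    ultimately have even: "even (degree (F - C) x)" for x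
      using less.prems(2)[of x] by simp
    \<comment> \<open>The path has \<open>length p - 1\<close> edges, and the closing edge makes up
      the difference.\<close>
    have cardC: "card C = length p"
      using new card_walk_edges[OF pw(3)] pw(1) by (simp add: C_def finite_walk_edges)
    have card: "card F = card C + card (F - C)"
      using CF fin card_Diff_subset[of C F] card_mono[OF fin CF] finite_subset by fastforce
    have "card (F - C) mod 4 = 0"
      using less.hyps[of "F - C"] even card cardC pw(1) less.prems(1) by auto
    then show ?thesis using card cardC len by presburger
  qed simp
qed

text \<open>Splits \<open>P\<close> by use of \<open>e\<close>: disjointness allows one path through
  \<open>e\<close>, and \<open>unique\<close> allows one avoiding it.\<close>

lemma card_le_2_if_avoiding_unique:
  assumes "edge_disjoint P" "finite P"
    and unique: "\<And>p q. \<lbrakk>p \<in> P; q \<in> P; e \<notin> walk_edges p; e \<notin> walk_edges q\<rbrakk> \<Longrightarrow> p = q"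
  shows "card P \<le> 2"
proof -
  let ?A = "{p \<in> P. e \<in> walk_edges p}" and ?B = "{p \<in> P. e \<notin> walk_edges p}"
  have "p = q" if "p \<in> ?A" "q \<in> ?A" for p q
    using that assms(1) by (auto simp: edge_disjoint_def pairwise_def disjnt_iff)
  then have "card ?A \<le> 1" using assms(2) card_le_Suc0_iff_eq[of ?A] by auto
  moreover have "card ?B \<le> 1" using assms(2) unique card_le_Suc0_iff_eq[of ?B] by auto
  moreover have "P = ?A \<union> ?B" by blast
  then have "card P \<le> card ?A + card ?B" by (metis card_Un_le)
  ultimately show ?thesis by linarith
qed

theorem theorem5:
  fixes V :: "'a set" and E :: "'a set set" and u v :: 'a
  assumes "epsilon0 V E" and "{u, v} \<in> E"
  shows "max_edge_disjoint_paths V E u v = 2"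
proof -
  have sE: "simple_graph V E" and cyc: "\<And>c. is_cycle V E c \<Longrightarrow> length c mod 4 = 0"
    and evV: "\<And>x. x \<in> V \<Longrightarrow> even (degree E x)"
    using assms(1) by (auto simp: epsilon0_def euler_graph_def)
  have uv: "u \<noteq> v" "u \<in> V" "v \<in> V" using simple_graph_edgeD[OF sE assms(2)] by auto
  \<comment> \<open>The parity lemmas quantify over the whole type, so points outside
    \<open>V\<close> are given degree 0.\<close>
  have "{e \<in> E. x \<in> e} = {}" if "x \<notin> V" for x
    using sE that by (auto simp: simple_graph_def)
  then have "degree E x = 0" if "x \<notin> V" for x
    unfolding degree_def using that by (metis card.empty)
  then have even: "even (degree E x)" for x using evV by (cases "x \<in> V") auto
  have upper: "card P \<le> 2" if P: "P \<subseteq> paths V E u v" "edge_disjoint P" for P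
  proof (rule card_le_2_if_avoiding_unique[where e = "{u, v}"])
    show "edge_disjoint P" by fact
    show "finite P" using finite_subset[OF P(1) finite_paths[OF sE]] .
    fix p q
    assume pq: "p \<in> P" "q \<in> P" and avoid: "{u, v} \<notin> walk_edges p" "{u, v} \<notin> walk_edges q"
    show "p = q"
    proof (rule ccontr)
      assume "p \<noteq> q"
      then have disj: "walk_edges p \<inter> walk_edges q = {}"
        using P(2) pq by (auto simp: edge_disjoint_def pairwise_def disjnt_def)
      have p: "p \<noteq> []" "walk_edges p \<subseteq> E" "distinct p" "hd p = u" "last p = v"
        and q: "q \<noteq> []" "walk_edges q \<subseteq> E" "distinct q" "hd q = u" "last q = v"
        using P(1) pq by (auto simp: paths_def is_walk_def)
      have "length p mod 4 = 0" "length q mod 4 = 0"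
        using pq P(1) avoid by (auto intro!: cyc path_closes_to_cycle[OF assms(2) uv(1)])
      moreover have "card (walk_edges p \<union> walk_edges q) = (length p - 1) + (length q - 1)"
        using disj p(3) q(3) by (simp add: card_Un_disjoint finite_walk_edges card_walk_edges)
      moreover have "card (walk_edges p \<union> walk_edges q) mod 4 = 0"
      proof (rule card_even_edge_set_mod_4[OF sE cyc])
        show "walk_edges p \<union> walk_edges q \<subseteq> E" using p q by blast
        \<comment> \<open>Both paths have the same odd vertices \<open>u\<close> and
          \<open>v\<close>, so the parities cancel.\<close>
        show "even (degree (walk_edges p \<union> walk_edges q) x)" for x
          using odd_degree_walk_edges[OF p(3,1), of x] odd_degree_walk_edges[OF q(3,1), of x] p q
          unfolding degree_Un_disjoint[OF finite_walk_edges finite_walk_edges disj] even_add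
          by metis
      qed
      \<comment> \<open>Positivity rules out truncated subtraction: each \<open>length - 1\<close>
        is 3 modulo 4, so the sum is 2 modulo 4.\<close>
      moreover have "length p > 0" "length q > 0" using p q by auto
      ultimately show False by presburger
    qed
  qed
  obtain p where p: "p \<in> paths V (E - {{u, v}}) u v"
    using path_avoiding_edge[OF sE even assms(2)] by blast
  \<comment> \<open>The bound is attained by the edge itself together with a path avoiding
    it.\<close>
  let ?P = "{[u, v], p}"
  have avoid: "{u, v} \<notin> walk_edges p" using p by (auto simp: paths_def is_walk_def)
  then have "[u, v] \<noteq> p" by auto
  then have card: "card ?P = 2" by simp
  have "[u, v] \<in> paths V E u v"
    using uv assms(2) by (auto simp: paths_def is_walk_def)
  then have "?P \<subseteq> paths V E u v" using p paths_mono[of "E - {{u, v}}" E] by blast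
  moreover have "edge_disjoint ?P"
    using avoid by (auto simp: edge_disjoint_def pairwise_def disjnt_iff)
  ultimately have "2 \<in> card ` {P. P \<subseteq> paths V E u v \<and> edge_disjoint P}"
    using card by (metis (mono_tags, lifting) image_eqI mem_Collect_eq)
  then show ?thesis
    unfolding max_edge_disjoint_paths_def
    using upper by (intro Max_eqI max_edge_disjoint_paths_wf[OF sE]) auto
qed

end
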